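(* Let $\mu$ be an AMS measure on $(\mathbb{X}^{\mathbb{Z}},\mathcal{X}^{\mathbb{Z}})$, let $L\in\mathbb{N}$, and let $f:\mathbb{X}\to\mathbb{Y}^L$ be a prefix-free fixed-length coding (i.e. an injection into strings of length $L$). Then, for the measure $\nu=\mu\circ(f^{\mathbb{Z}})^{-1}$ and all $n\in\mathbb{N}$, $$\left|H_{\bar\nu}(nL)-H_{\bar\mu}(n)\right|\le H_{\bar\mu}(2)+\log L.$$
   Context: $\mathbb{X},\mathbb{Y}$ are countable alphabets, $\mathbb{N}=\{1,2,\dots\}$; $(\mathbb{X}^{\mathbb{Z}},\mathcal{X}^{\mathbb{Z}})$, $(\mathbb{Y}^{\mathbb{Z}},\mathcal{Y}^{\mathbb{Z}})$ are the spaces of two-sided sequences with product $\sigma$-algebras; "measure" means probability measure; $T((x_i)_{i\in\mathbb{Z}})=(x_{i+1})_{i\in\mathbb{Z}}$ is the shift. A measure $\mu$ is asymptotically mean stationary (AMS) if $\bar\mu(A)=\lim_{n\to\infty}\frac1n\sum_{i=0}^{n-1}\mu(T^{-i}A)$ exists for every measurable $A$; $\bar\mu$ is then a stationary probability measure called the stationary mean of $\mu$. Under the hypotheses $\nu$ is AMS, so $\bar\nu$ is well defined. $f^{\mathbb{Z}}(x^{\mathbb{Z}})=\dots f(x_{-1})f(x_0)\mathbf{.}f(x_1)f(x_2)\dots$ is the two-sided concatenation ($f(x_1)$ starts at coordinate $1$). With cylinders $[u]=\{x^{\mathbb{Z}}:x_1\dots x_{|u|}=u\}$, block entropy of a measure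 $\mu$ on $\mathbb{X}^{\mathbb{Z}}$ is $H_\mu(n)=-\sum_{u\in\mathbb{X}^n}\mu([u])\log\mu([u])\in[0,\infty]$ (with $0\log0=0$), and analogously over $\mathbb{Y}$. The inequality is regarded as vacuously true when $H_{\bar\mu}(2)=\infty$. *)

theory Defs
  imports "HOL-Probability.Probability"
begin

definition seq_space :: "(int \<Rightarrow> 'a::countable) measure" where
  "seq_space = PiM UNIV (\<lambda>_. count_space UNIV)"

definition shift :: "(int \<Rightarrow> 'a) \<Rightarrow> (int \<Rightarrow> 'a)" where
  "shift x = (\<lambda>i. x (i + 1))"

definition shift_average :: "(int \<Rightarrow> 'a) measure \<Rightarrow> (int \<Rightarrow> 'a) set \<Rightarrow> nat \<Rightarrow> real" where
  "shift_average M A n = (\<Sum>i<n. measure M ((shift ^^ i) -` A)) / real n"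

definition ams :: "(int \<Rightarrow> 'a::countable) measure \<Rightarrow> bool" where
  "ams M \<longleftrightarrow> prob_space M \<and> sets M = sets seq_space \<and>
     (\<forall>A\<in>sets seq_space. convergent (shift_average M A))"

(* measure_of returns the zero measure for a set function that is not countably additive.
   For AMS measures this case does not arise, by the Vitali-Hahn-Saks theorem. *)
definition stationary_mean :: "(int \<Rightarrow> 'a::countable) measure \<Rightarrow> (int \<Rightarrow> 'a) measure" where
  "stationary_mean M =
     measure_of (space seq_space) (sets seq_space) (\<lambda>A. ennreal (lim (shift_average M A)))"

definition cylinder :: "'a list \<Rightarrow> (int \<Rightarrow> 'a) set" where
  "cylinder u = {x. \<forall>i<length u. x (int i + 1) = u ! i}"

(* Natural logarithm; ln 0 = 0 in HOL, so null cylinders contribute 0. *)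
definition block_entropy :: "(int \<Rightarrow> 'a) measure \<Rightarrow> nat \<Rightarrow> ereal" where
  "block_entropy M n =
     (\<Sum>\<^sub>\<infinity>u\<in>{u. length u = n}.
        ereal (- (measure M (cylinder u) * ln (measure M (cylinder u)))))"

(* ... f(x_(-1)) f(x_0) . f(x_1) f(x_2) ... : coordinate j \<ge> 1 is the j-th symbol of
   f(x_1) f(x_2) ..., and coordinate j \<le> 0 is the (1-j)-th symbol from the right of
   ... f(x_(-1)) f(x_0). If all codewords are nonempty, the codewords of x_1, ..., x_j
   (resp. x_j, ..., x_0) are enough to reach coordinate j. *)
definition two_sided_concat :: "('a \<Rightarrow> 'b list) \<Rightarrow> (int \<Rightarrow> 'a) \<Rightarrow> (int \<Rightarrow> 'b)" where
  "two_sided_concat f x = (\<lambda>j.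
     if j \<ge> 1 then concat (map (\<lambda>i. f (x i)) [1..j]) ! nat (j - 1)
     else rev (concat (map (\<lambda>i. f (x i)) [j..0])) ! nat (- j))"

end

theory Submission
  imports Defs
begin

text \<open>
  Write \<open>F\<close> for the two-sided concatenation and \<open>T\<close> for the shift. Since all code words have
  length \<open>L\<close>, one step of \<open>T\<close> in the source is \<open>L\<close> steps in the coded sequence. Splitting the
  averages of \<open>\<nu>\<close> along residue classes modulo \<open>L\<close> therefore shows that \<open>\<nu>\<close> is AMS, and that its
  stationary mean is the uniform mixture over \<open>r < L\<close> of the laws of \<open>T\<^sup>r (F x)\<close>, where \<open>x\<close> has the
  stationary mean of \<open>\<mu>\<close> as its law (\<open>measure_stationary_mean_coded\<close>). In words: the stationary
  coded source is the coded stationary source seen with a uniformly random phase \<open>r\<close>.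

  The first \<open>n * L\<close> symbols of \<open>T\<^sup>r (F x)\<close> form a window that begins inside the code word of
  \<open>x\<^sub>1\<close> and ends no later than the code word of \<open>x\<^sub>n\<^sub>+\<^sub>1\<close>. So the window is a function of
  \<open>x\<^sub>1 \<dots> x\<^sub>n\<^sub>+\<^sub>1\<close>, and by injectivity of the code it determines \<open>x\<^sub>2 \<dots> x\<^sub>n\<close>. With \<open>H k\<close> the
  entropy of a block of length \<open>k\<close> of the stationary mean of \<open>\<mu>\<close>, the entropy of each window thus
  lies between \<open>H (n - 1)\<close> and \<open>H (n + 1)\<close> (\<open>entropy_window_ge\<close>, \<open>entropy_window_le\<close>). By
  stationarity and subadditivity, \<open>H n - H 1 \<le> H (n - 1)\<close> and \<open>H (n + 1) \<le> H n + H 1\<close>.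
  A uniform mixture of \<open>L\<close> distributions has at least the least of their entropies and at most the
  greatest plus \<open>ln L\<close> (\<open>pmf_entropy_mixture_ge\<close>, \<open>pmf_entropy_mixture_le\<close>). Together,
  \<open>H n - H 1 \<le> H\<^sub>\<nu> (n * L) \<le> H n + H 1 + ln L\<close>, and \<open>H 1 \<le> H 2\<close>.

  All entropies are kept in \<^typ>\<open>ennreal\<close> as expectations of \<open>- ln\<close> of the probability
  mass function, so that infinite values need no separate treatment before the last step.

  Setwise convergence of the averages also has to give a countably additive limit; otherwise
  \<^const>\<open>stationary_mean\<close> would degenerate to the zero measure. This is the Nikodym convergence
  theorem, proved here with a gliding hump (\<open>nikodym_continuity_at_empty\<close>).
\<close>

section \<open>Limits of sequences of measures\<close>

text \<open>
  Gliding hump. If the limit \<open>v\<close> kept mass at least \<open>\<delta> > 0\<close> on every \<open>A i\<close>, then at later and later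
  times \<open>n\<^sub>j\<close> almost all of that mass would sit on a shell \<open>A (k\<^sub>j) - A (k\<^sub>j\<^sub>+\<^sub>1)\<close>, because each
  \<open>m n\<close> is itself continuous at the empty set. Let \<open>S\<close> be the union of every second shell. At even
  steps \<open>S\<close> contains the current hump, at odd steps it misses it, so \<open>m (n\<^sub>j) S\<close> oscillates by
  almost \<open>\<delta>\<close> and cannot converge.
\<close>

lemma nikodym_continuity_at_empty:
  fixes m :: "nat \<Rightarrow> 'a set \<Rightarrow> real" and v :: "'a set \<Rightarrow> real"
  assumes S: "sigma_algebra \<Omega> \<A>"
    and nonneg: "\<And>n A. A \<in> \<A> \<Longrightarrow> 0 \<le> m n A"
    and add: "\<And>n A B. A \<in> \<A> \<Longrightarrow> B \<in> \<A> \<Longrightarrow> A \<inter> B = {} \<Longrightarrow> m n (A \<union> B) = m n A + m n B"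
    and cont: "\<And>n A. range A \<subseteq> \<A> \<Longrightarrow> decseq A \<Longrightarrow> (\<Inter>i. A i) = {} \<Longrightarrow> (\<lambda>i. m n (A i)) \<longlonglongrightarrow> 0"
    and lim: "\<And>A. A \<in> \<A> \<Longrightarrow> (\<lambda>n. m n A) \<longlonglongrightarrow> v A"
    and A: "range A \<subseteq> \<A>" "decseq A" "(\<Inter>i. A i) = {}"
  shows "(\<lambda>i. v (A i)) \<longlonglongrightarrow> 0"
proof -
  interpret sigma_algebra \<Omega> \<A> by fact
  have mono: "m n B \<le> m n C" if "B \<in> \<A>" "C \<in> \<A>" "B \<subseteq> C" for n B C
    using add[of B "C - B" n] nonneg[of "C - B" n] Diff[OF that(2,1)] that by (simp add: Un_absorb1)
  have diff: "m n (C - B) = m n C - m n B" if "B \<in> \<A>" "C \<in> \<A>" "B \<subseteq> C" for n B C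
    using add[of B "C - B" n] Diff[OF that(2,1)] that by (simp add: Un_absorb1)
  have v_nonneg: "0 \<le> v B" if "B \<in> \<A>" for B
    using LIMSEQ_le_const[OF lim[OF that]] nonneg[OF that] by blast
  have v_mono: "v B \<le> v C" if "B \<in> \<A>" "C \<in> \<A>" "B \<subseteq> C" for B C
    using LIMSEQ_le[OF lim[OF that(1)] lim[OF that(2)]] mono[OF that] by blast
  have AA: "A i \<in> \<A>" for i using A(1) by auto
  have Adec: "A j \<subseteq> A i" if "i \<le> j" for i j using A(2) that by (auto simp: decseq_def)
  have "decseq (\<lambda>i. v (A i))"
    by (auto simp: decseq_def intro!: v_mono AA Adec)
  moreover have "\<And>i. 0 \<le> v (A i)" by (rule v_nonneg[OF AA])
  ultimately obtain \<delta> where \<delta>: "(\<lambda>i. v (A i)) \<longlonglongrightarrow> \<delta>" "\<And>i. \<delta> \<le> v (A i)"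
    using decseq_convergent by blast
  have "0 \<le> \<delta>" using LIMSEQ_le_const[OF \<delta>(1)] v_nonneg[OF AA] by blast
  have "\<delta> = 0"
  proof (rule ccontr)
    assume "\<delta> \<noteq> 0"
    \<comment> \<open>The two bounds on \<open>v S\<close> at the end contradict each other as soon as \<open>5 * \<epsilon> < \<delta>\<close>.\<close>
    define \<epsilon> where "\<epsilon> = \<delta> / 7"
    have \<epsilon>: "0 < \<epsilon>" "\<delta> = 7 * \<epsilon>" using \<open>0 \<le> \<delta>\<close> \<open>\<delta> \<noteq> 0\<close> by (auto simp: \<epsilon>_def)
    \<comment> \<open>A state holds the current index \<open>k\<close>, the union \<open>U\<close> of the shells collected so far, a time
      \<open>n\<close> at which \<open>m n\<close> is already close to the limit on \<open>U\<close>, and the next index \<open>l\<close>,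
      beyond which \<open>m n\<close> has hardly any mass.\<close>
    define P where "P j s \<longleftrightarrow> (case s of (k, U, n, l) \<Rightarrow>
        U \<in> \<A> \<and> U \<inter> A k = {} \<and> k \<le> l \<and> j \<le> n \<and> \<delta> - \<epsilon> < m n (A k) \<and>
        \<bar>m n U - v U\<bar> < \<epsilon> \<and> m n (A l) < \<epsilon>)" for j :: nat and s :: "nat \<times> 'a set \<times> nat \<times> nat"
    define Q where "Q j s t \<longleftrightarrow> (case s of (k, U, n, l) \<Rightarrow> case t of (k', U', n', l') \<Rightarrow>
        k' = l \<and> U' = (if even j then U \<union> (A k - A l) else U))"
      for j :: nat and s t :: "nat \<times> 'a set \<times> nat \<times> nat"
    have ex: "\<exists>n l. P j (k, U, n, l)" if "U \<in> \<A>" "U \<inter> A k = {}" for j k U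
    proof -
      have "eventually (\<lambda>n. \<delta> - \<epsilon> < m n (A k)) sequentially"
        using order_tendstoD(1)[OF lim[OF AA[of k]], of "\<delta> - \<epsilon>"] \<delta>(2)[of k] \<epsilon>(1) by simp
      moreover have "eventually (\<lambda>n. \<bar>m n U - v U\<bar> < \<epsilon>) sequentially"
        using tendstoD[OF lim[OF that(1)] \<epsilon>(1)] by (simp add: dist_real_def)
      ultimately have "eventually (\<lambda>n. \<delta> - \<epsilon> < m n (A k) \<and> \<bar>m n U - v U\<bar> < \<epsilon> \<and> j \<le> n) sequentially"
        using eventually_ge_at_top[of j] by eventually_elim auto
      then obtain n where n: "\<delta> - \<epsilon> < m n (A k)" "\<bar>m n U - v U\<bar> < \<epsilon>" "j \<le> n"
        by (metis (mono_tags, lifting) eventually_happens' sequentially_bot)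
      have "eventually (\<lambda>l. m n (A l) < \<epsilon>) sequentially"
        using order_tendstoD(2)[OF cont[OF A]] \<epsilon>(1) by blast
      then have "eventually (\<lambda>l. m n (A l) < \<epsilon> \<and> k \<le> l) sequentially"
        using eventually_ge_at_top[of k] by eventually_elim auto
      then obtain l where "m n (A l) < \<epsilon>" "k \<le> l"
        by (metis (mono_tags, lifting) eventually_happens' sequentially_bot)
      with n that show ?thesis by (auto simp: P_def)
    qed
    have "\<exists>s. \<forall>j. P j (s j) \<and> Q j (s j) (s (Suc j))"
    proof (rule dependent_nat_choice)
      show "\<exists>s. P 0 s" using ex[of "{}" 0 0] by auto
    next
      fix s j assume s: "P j s"
      obtain k U n l where [simp]: "s = (k, U, n, l)" by (cases s)
      let ?U = "if even j then U \<union> (A k - A l) else U"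
      have "k \<le> l" "U \<in> \<A>" "U \<inter> A k = {}" using s by (auto simp: P_def)
      then have "?U \<in> \<A>" "?U \<inter> A l = {}" using AA Adec[of k l] by auto
      then obtain n' l' where "P (Suc j) (l, ?U, n', l')" using ex by blast
      then show "\<exists>t. P (Suc j) t \<and> Q j s t"
        by (intro exI[of _ "(l, ?U, n', l')"]) (auto simp: Q_def)
    qed
    then obtain s where s: "\<And>j. P j (s j)" "\<And>j. Q j (s j) (s (Suc j))" by blast
    define k U n where "k j = fst (s j)" and "U j = fst (snd (s j))" and "n j = fst (snd (snd (s j)))" for j
    have l: "snd (snd (snd (s j))) = k (Suc j)" for j
      using s(2)[of j] by (auto simp: Q_def k_def split: prod.splits)
    have st: "s j = (k j, U j, n j, k (Suc j))" for j
      unfolding l[symmetric] by (simp add: k_def U_def n_def)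
    have UA: "U j \<in> \<A>" and Uk: "U j \<inter> A (k j) = {}" and kk: "k j \<le> k (Suc j)" and nj: "j \<le> n j"
      and big: "\<delta> - \<epsilon> < m (n j) (A (k j))" and close: "\<bar>m (n j) (U j) - v (U j)\<bar> < \<epsilon>"
      and small: "m (n j) (A (k (Suc j))) < \<epsilon>" for j
      using s(1)[of j] unfolding st P_def by auto
    have USuc: "U (Suc j) = (if even j then U j \<union> (A (k j) - A (k (Suc j))) else U j)" for j
      using s(2)[of j] unfolding st Q_def by auto
    have incU: "U i \<subseteq> U j" if "i \<le> j" for i j
      using lift_Suc_mono_le[of U i j] USuc that by auto
    \<comment> \<open>Whatever is collected after step \<open>i\<close> lies inside \<open>A (k i)\<close>.\<close>
    have late: "U j \<subseteq> U i \<union> A (k i)" if "i \<le> j" for i j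
      using that
    proof (induction j rule: dec_induct)
      case (step j)
      have "A (k j) \<subseteq> A (k i)" using lift_Suc_mono_le[of k, OF kk] step.hyps Adec by simp
      then show ?case using step.IH USuc[of j] by auto
    qed auto
    define S where "S = (\<Union>j. U j)"
    have SA: "S \<in> \<A>" unfolding S_def using UA by auto
    have "incseq (\<lambda>j. v (U j))" by (auto simp: incseq_def intro!: v_mono UA incU)
    moreover have "v (U j) \<le> v S" for j by (intro v_mono UA SA) (auto simp: S_def)
    ultimately obtain u where u: "(\<lambda>j. v (U j)) \<longlonglongrightarrow> u"
      using incseq_convergent by blast
    have nlim: "filterlim n at_top sequentially"
      by (rule filterlim_at_top_mono[OF filterlim_ident]) (use nj in auto)
    have mlim: "(\<lambda>j. m (n j) S) \<longlonglongrightarrow> v S"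
      using filterlim_compose[OF lim[OF SA] nlim] .
    have lower: "m (n j) S \<ge> v (U j) + \<delta> - 3 * \<epsilon>" if "even j" for j
    proof -
      have "U j \<union> (A (k j) - A (k (Suc j))) \<subseteq> S" using USuc[of j] that by (auto simp: S_def)
      then have "m (n j) (U j \<union> (A (k j) - A (k (Suc j)))) \<le> m (n j) S"
        by (intro mono SA) (auto intro: UA AA)
      moreover have "m (n j) (U j \<union> (A (k j) - A (k (Suc j))))
          = m (n j) (U j) + (m (n j) (A (k j)) - m (n j) (A (k (Suc j))))"
        using Uk[of j] by (subst add) (auto intro: UA AA simp: diff[OF AA AA Adec[OF kk]])
      ultimately show ?thesis using big[of j] close[of j] small[of j] by linarith
    qed
    have upper: "m (n j) S \<le> v (U j) + 2 * \<epsilon>" if "odd j" for j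
    proof -
      have "U i \<subseteq> U j \<union> A (k (Suc j))" for i
      proof (cases "Suc j \<le> i")
        case True then show ?thesis using late[OF True] USuc[of j] that by auto
      next
        case False then show ?thesis using incU[of i j] by auto
      qed
      then have "S \<subseteq> U j \<union> A (k (Suc j))" by (auto simp: S_def)
      then have "m (n j) S \<le> m (n j) (U j \<union> A (k (Suc j)))"
        by (intro mono SA) (auto intro: UA AA)
      also have "\<dots> = m (n j) (U j) + m (n j) (A (k (Suc j)))"
        using Uk[of j] Adec[OF kk[of j]] by (intro add UA AA) auto
      finally show ?thesis using close[of j] small[of j] by linarith
    qed
    have sub: "filterlim (\<lambda>j. 2 * j) sequentially sequentially"
              "filterlim (\<lambda>j. 2 * j + 1) sequentially sequentially"
      by (auto intro!: filterlim_at_top_mono[OF filterlim_ident] simp: eventually_sequentially)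
    have "u + \<delta> - 3 * \<epsilon> \<le> v S"
      by (rule LIMSEQ_le[OF tendsto_diff[OF tendsto_add[OF filterlim_compose[OF u sub(1)] tendsto_const] tendsto_const]
            filterlim_compose[OF mlim sub(1)]]) (use lower in auto)
    moreover have "v S \<le> u + 2 * \<epsilon>"
      by (rule LIMSEQ_le[OF filterlim_compose[OF mlim sub(2)] tendsto_add[OF filterlim_compose[OF u sub(2)] tendsto_const]])
         (use upper in auto)
    ultimately show False using \<epsilon> by linarith
  qed
  with \<delta>(1) show ?thesis by simp
qed

section \<open>Stationary means\<close>

lemma space_seq_space [simp]: "space seq_space = UNIV"
  by (simp add: seq_space_def space_PiM)

lemma shift_funpow: "(shift ^^ k) x = (\<lambda>i. x (i + int k))"
  by (induction k arbitrary: x) (simp_all add: shift_def funpow_swap1 algebra_simps)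

lemma measurable_coordinate [measurable]: "(\<lambda>x. x i) \<in> seq_space \<rightarrow>\<^sub>M count_space UNIV"
  unfolding seq_space_def by simp

lemma measurable_seq_spaceI:
  assumes "\<And>i. (\<lambda>x. g x i) \<in> M \<rightarrow>\<^sub>M count_space UNIV"
  shows "g \<in> M \<rightarrow>\<^sub>M seq_space"
  unfolding seq_space_def by (rule measurable_PiM_single') (use assms in auto)

lemma measurable_shift_funpow [measurable]: "shift ^^ k \<in> seq_space \<rightarrow>\<^sub>M seq_space"
  by (rule measurable_seq_spaceI) (simp add: shift_funpow)

lemma vimage_shift_funpow_sets: "A \<in> sets seq_space \<Longrightarrow> (shift ^^ k) -` A \<in> sets seq_space"
  using measurable_sets[OF measurable_shift_funpow, of A k] by simp

text \<open>
  The shift averages are finitely additive and continuous at the empty set, being averages of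
  finitely many measures, so the convergence theorem above makes their limit countably additive.
\<close>

lemma stationary_mean_measure:
  fixes M :: "(int \<Rightarrow> 'a::countable) measure"
  assumes "ams M"
  shows sets_stationary_mean: "sets (stationary_mean M) = sets seq_space"
    and prob_space_stationary_mean: "prob_space (stationary_mean M)"
    and shift_average_tendsto:
      "A \<in> sets seq_space \<Longrightarrow> shift_average M A \<longlonglongrightarrow> measure (stationary_mean M) A"
proof -
  interpret prob_space M using assms by (simp add: ams_def)
  have sets_M: "sets M = sets seq_space" using assms by (simp add: ams_def)
  have space_M: "space M = UNIV" using sets_eq_imp_space_eq[OF sets_M] by simp
  define v where "v A = lim (shift_average M A)" for A
  have v: "shift_average M A \<longlonglongrightarrow> v A" if "A \<in> sets seq_space" for A
    using assms that by (simp add: ams_def v_def convergent_LIMSEQ_iff)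
  have nonneg: "0 \<le> shift_average M A n" for A n
    by (simp add: shift_average_def sum_nonneg)
  have add: "shift_average M (A \<union> B) n = shift_average M A n + shift_average M B n"
    if "A \<in> sets seq_space" "B \<in> sets seq_space" "A \<inter> B = {}" for A B n
  proof -
    have "measure M ((shift ^^ i) -` (A \<union> B)) = measure M ((shift ^^ i) -` A) + measure M ((shift ^^ i) -` B)" for i
      unfolding vimage_Un using that
      by (intro finite_measure_Union) (auto simp: sets_M vimage_shift_funpow_sets)
    then show ?thesis by (simp add: shift_average_def sum.distrib add_divide_distrib)
  qed
  have cont: "(\<lambda>i. shift_average M (A i) n) \<longlonglongrightarrow> 0"
    if A: "range A \<subseteq> sets seq_space" "decseq A" "(\<Inter>i. A i) = {}" for A n
  proof -
    have "(\<lambda>i. measure M ((shift ^^ k) -` A i)) \<longlonglongrightarrow> 0" for k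
    proof -
      have "(\<lambda>i. measure M ((shift ^^ k) -` A i)) \<longlonglongrightarrow> measure M (\<Inter>i. (shift ^^ k) -` A i)"
      proof (intro finite_Lim_measure_decseq)
        show "range (\<lambda>i. (shift ^^ k) -` A i) \<subseteq> sets M"
          using A(1) by (auto simp: sets_M intro!: vimage_shift_funpow_sets)
        show "decseq (\<lambda>i. (shift ^^ k) -` A i)"
          using A(2) by (fastforce simp: decseq_def)
      qed
      also have "(\<Inter>i. (shift ^^ k) -` A i) = {}" using A(3) by (simp flip: vimage_INT)
      finally show ?thesis by simp
    qed
    then have "(\<lambda>i. \<Sum>k<n. measure M ((shift ^^ k) -` A i)) \<longlonglongrightarrow> (\<Sum>k<n. 0)"
      by (intro tendsto_sum) simp
    then have "(\<lambda>i. (\<Sum>k<n. measure M ((shift ^^ k) -` A i)) * (1 / real n)) \<longlonglongrightarrow> 0 * (1 / real n)"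
      by (intro tendsto_mult_right) simp
    then show ?thesis by (simp add: shift_average_def)
  qed
  have v_nonneg: "0 \<le> v A" if "A \<in> sets seq_space" for A
    using LIMSEQ_le_const[OF v[OF that]] nonneg by blast
  have v_add: "v (A \<union> B) = v A + v B" if "A \<in> sets seq_space" "B \<in> sets seq_space" "A \<inter> B = {}" for A B
  proof (rule LIMSEQ_unique[OF v])
    show "shift_average M (A \<union> B) \<longlonglongrightarrow> v A + v B"
      unfolding add[OF that, abs_def] using that by (intro tendsto_add v)
  qed (use that in auto)
  have v_cont: "(\<lambda>i. v (A i)) \<longlonglongrightarrow> 0"
    if A: "range A \<subseteq> sets seq_space" "decseq A" "(\<Inter>i. A i) = {}" for A
    by (rule nikodym_continuity_at_empty[where \<A> = "sets seq_space" and \<Omega> = UNIV and m = "\<lambda>n A. shift_average M A n"])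
      (use sets.sigma_algebra_axioms[of seq_space] nonneg add cont v A in auto)
  have v_empty: "v {} = 0" using v_add[of "{}" "{}"] by simp
  have pos: "positive (sets seq_space) (\<lambda>A. ennreal (v A))"
    by (simp add: positive_def v_empty)
  have "countably_additive (sets seq_space) (\<lambda>A. ennreal (v A))"
  proof (rule sets.empty_continuous_imp_countably_additive[OF pos])
    show "additive (sets seq_space) (\<lambda>A. ennreal (v A))"
      by (auto simp: additive_def v_add v_nonneg ennreal_plus)
    show "(\<lambda>i. ennreal (v (A i))) \<longlonglongrightarrow> 0"
      if "range A \<subseteq> sets seq_space" "decseq A" "(\<Inter>i. A i) = {}" for A
      using tendsto_ennrealI[OF v_cont[OF that]] by simp
  qed simp
  then have emeasure: "emeasure (stationary_mean M) A = ennreal (v A)" if "A \<in> sets seq_space" for A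
    unfolding stationary_mean_def v_def[symmetric]
    by (intro emeasure_measure_of_sigma[OF _ pos]) (use sets.sigma_algebra_axioms[of seq_space] that in auto)
  show sets: "sets (stationary_mean M) = sets seq_space"
    by (simp add: stationary_mean_def sets.sigma_sets_eq[of seq_space, simplified])
  have space: "space (stationary_mean M) = UNIV" using sets_eq_imp_space_eq[OF sets] by simp
  have UNIV_sets: "UNIV \<in> sets seq_space" using sets.top[of seq_space] by simp
  have "shift_average M UNIV n = 1" if "n \<ge> 1" for n
    using that prob_space by (simp add: shift_average_def space_M)
  then have "shift_average M UNIV \<longlonglongrightarrow> 1"
    by (intro tendsto_eventually) (auto simp: eventually_sequentially)
  then have "v UNIV = 1" by (rule LIMSEQ_unique[OF v[OF UNIV_sets]])
  then show "prob_space (stationary_mean M)"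
    by (intro prob_spaceI) (simp add: space emeasure UNIV_sets)
  show "shift_average M A \<longlonglongrightarrow> measure (stationary_mean M) A" if "A \<in> sets seq_space"
    using v[OF that] by (simp add: measure_def emeasure that v_nonneg)
qed

text \<open>
  Replacing \<open>A\<close> by its preimage under the shift drops the first summand and adds one new last summand,
  which changes the average by at most \<open>1 / n\<close>.
\<close>

lemma stationary_mean_vimage_shift:
  fixes M :: "(int \<Rightarrow> 'a::countable) measure"
  assumes M: "ams M" and A: "A \<in> sets seq_space"
  shows "measure (stationary_mean M) (shift -` A) = measure (stationary_mean M) A"
proof -
  interpret prob_space M using M by (simp add: ams_def)
  let ?a = "\<lambda>i. measure M ((shift ^^ i) -` A)"
  have A': "shift -` A \<in> sets seq_space" using vimage_shift_funpow_sets[OF A, of 1] by simp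
  have eq: "shift_average M (shift -` A) n = shift_average M A n + (?a n - ?a 0) / n" for n
  proof -
    have "(shift ^^ i) -` shift -` A = (shift ^^ Suc i) -` A" for i by (auto simp: funpow_swap1)
    then have "(\<Sum>i<n. measure M ((shift ^^ i) -` shift -` A)) = (\<Sum>i<n. ?a (Suc i))" by simp
    also have "\<dots> = (\<Sum>i<n. ?a i) + (?a n - ?a 0)"
      using sum_lessThan_telescope[of ?a n] by (simp add: sum_subtractf)
    finally show ?thesis by (simp add: shift_average_def add_divide_distrib)
  qed
  have "(\<lambda>n. (?a n - ?a 0) / n) \<longlonglongrightarrow> 0"
  proof (rule Lim_null_comparison)
    have "\<bar>?a n - ?a 0\<bar> \<le> 1" for n
      using measure_nonneg[of M "(shift ^^ n) -` A"] prob_le_1[of "(shift ^^ n) -` A"]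
        measure_nonneg[of M "(shift ^^ 0) -` A"] prob_le_1[of "(shift ^^ 0) -` A"] by linarith
    then show "eventually (\<lambda>n. norm ((?a n - ?a 0) / n) \<le> 1 / real n) sequentially"
      by (intro always_eventually allI) (simp add: divide_right_mono)
  qed (rule lim_1_over_n)
  from tendsto_add[OF shift_average_tendsto[OF M A] this]
  have "shift_average M (shift -` A) \<longlonglongrightarrow> measure (stationary_mean M) A" by (simp add: eq[abs_def])
  then show ?thesis using LIMSEQ_unique shift_average_tendsto[OF M A'] by blast
qed

section \<open>Coordinates of the concatenated sequence\<close>

lemma nth_concat_equal_length:
  assumes "\<And>x. length (g x) = L" "i < length xs * L"
  shows "concat (map g xs) ! i = g (xs ! (i div L)) ! (i mod L)"
  using assms(2)
proof (induction xs arbitrary: i)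
  case (Cons x xs)
  then have "L > 0" by (cases L) auto
  show ?case
  proof (cases "i < L")
    case False
    then have "i div L = Suc ((i - L) div L)" "i mod L = (i - L) mod L"
      using \<open>L > 0\<close> by (simp_all add: div_if mod_if)
    then show ?thesis using False Cons by (simp add: nth_append assms(1))
  qed (use assms(1) in \<open>simp add: nth_append\<close>)
qed simp

lemma length_concat_equal_length:
  assumes "\<And>x. length (g x) = L"
  shows "length (concat (map g xs)) = length xs * L"
  using assms by (induction xs) simp_all

text \<open>
  One formula covers both halves of the concatenation, because integer division rounds down:
  coordinate \<open>j\<close> belongs to the code word of \<open>x\<^sub>q\<^sub>+\<^sub>1\<close> with \<open>q = (j - 1) div L\<close>, also when \<open>j \<le> 0\<close>.
  Everything later about the concatenation, such as its measurability and its behaviour under the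
  shift, is read off from this formula.
\<close>

lemma two_sided_concat_coordinate:
  fixes f :: "'a \<Rightarrow> 'b list"
  assumes len: "\<And>x. length (f x) = L" and L: "L \<ge> 1"
  shows "two_sided_concat f x j = f (x ((j - 1) div int L + 1)) ! nat ((j - 1) mod int L)"
proof -
  have nth: "concat (map (\<lambda>i. f (x i)) [a..b]) ! i = f (x (a + int (i div L))) ! (i mod L)"
    if "i < nat (b - a + 1) * L" for a b i
  proof -
    have "i div L < nat (b - a + 1)" using that by (simp add: less_mult_imp_div_less)
    then have "[a..b] ! (i div L) = a + int (i div L)" by (intro nth_upto) linarith
    then show ?thesis using that len by (subst nth_concat_equal_length[where L = L]) simp_all
  qed
  show ?thesis
  proof (cases "j \<ge> 1")
    case True
    define i where "i = nat (j - 1)"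
    have j: "j = int i + 1" using True by (simp add: i_def)
    have "i < nat (j - 1 + 1) * L" using L mult_le_mono2[of 1 L "Suc i"] by (simp add: j nat_add_distrib)
    from nth[OF this] show ?thesis
      using True by (simp add: two_sided_concat_def j zdiv_int[symmetric] zmod_int[symmetric] add.commute)
  next
    case False
    define c where "c = concat (map (\<lambda>i. f (x i)) [j..0])"
    have lc: "length c = nat (1 - j) * L"
      unfolding c_def using len by (subst length_concat_equal_length[where L = L]) simp_all
    have le: "1 - j \<le> (1 - j) * int L" using False L by (simp add: mult_le_cancel_left1)
    have ilc: "int (length c) = (1 - j) * int L" using False by (simp add: lc)
    define i where "i = length c - Suc (nat (- j))"
    \<comment> \<open>Reversal turns position \<open>- j\<close> from the right into this position \<open>i\<close> from the left; it is
      congruent to \<open>j - 1\<close> modulo \<open>L\<close>.\<close>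
    have i: "int i = (j - 1) + (1 - j) * int L" using le ilc False unfolding i_def by linarith
    have "i < length c" using ilc i False by linarith
    have "two_sided_concat f x j = c ! i"
    proof -
      have "nat (- j) < length c" using False le ilc by linarith
      then show ?thesis
        using False by (simp add: two_sided_concat_def c_def[symmetric] rev_nth i_def)
    qed
    also have "\<dots> = f (x (j + int (i div L))) ! (i mod L)"
      unfolding c_def using \<open>i < length c\<close> lc by (intro nth) (simp add: algebra_simps)
    also have "int (i div L) = (j - 1) div int L + (1 - j)"
      using L by (simp add: zdiv_int i)
    also have "i mod L = nat ((j - 1) mod int L)"
      using L by (simp add: nat_eq_iff2 zmod_int i)
    finally show ?thesis by (simp add: add.commute)
  qed
qed

lemma two_sided_concat_shift:
  fixes f :: "'a \<Rightarrow> 'b list"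
  assumes "\<And>x. length (f x) = L" and "L \<ge> 1"
  shows "two_sided_concat f ((shift ^^ k) x) = (shift ^^ (k * L)) (two_sided_concat f x)"
proof
  fix j
  have "j + int (k * L) - 1 = (j - 1) + int k * int L" by simp
  then have "(j + int (k * L) - 1) div int L = (j - 1) div int L + int k"
    "(j + int (k * L) - 1) mod int L = (j - 1) mod int L"
    using assms(2) by (simp_all only:) simp_all
  then show "two_sided_concat f ((shift ^^ k) x) j = (shift ^^ (k * L)) (two_sided_concat f x) j"
    by (simp only: shift_funpow two_sided_concat_coordinate[of f L, OF assms]) (simp add: algebra_simps)
qed

lemma measurable_two_sided_concat:
  fixes f :: "'a::countable \<Rightarrow> 'b::countable list"
  assumes "\<And>x. length (f x) = L" and "L \<ge> 1"
  shows "two_sided_concat f \<in> seq_space \<rightarrow>\<^sub>M seq_space"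
proof (rule measurable_seq_spaceI)
  fix j
  have "(\<lambda>x. f (x ((j - 1) div int L + 1)) ! nat ((j - 1) mod int L)) \<in> seq_space \<rightarrow>\<^sub>M count_space UNIV"
    by (rule measurable_compose[OF measurable_coordinate]) simp
  then show "(\<lambda>x. two_sided_concat f x j) \<in> seq_space \<rightarrow>\<^sub>M count_space UNIV"
    by (simp add: two_sided_concat_coordinate[of f L, OF assms])
qed

section \<open>The stationary mean of a coded measure\<close>

text \<open>
  Up to the last multiple of \<open>L\<close> before \<open>n\<close>, fewer than \<open>L\<close> bounded summands are missing, which
  vanish after division by \<open>n\<close>.
\<close>

lemma averages_tendsto_from_multiples:
  fixes a :: "nat \<Rightarrow> real"
  assumes a: "\<And>i. 0 \<le> a i" "\<And>i. a i \<le> 1" and L: "L \<ge> 1"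
    and lim: "(\<lambda>m. (\<Sum>i<m * L. a i) / real (m * L)) \<longlonglongrightarrow> s"
  shows "(\<lambda>n. (\<Sum>i<n. a i) / real n) \<longlonglongrightarrow> s"
proof -
  define S where "S n = (\<Sum>i<n. a i)" for n
  define m where "m n = n div L" for n
  have n: "n = m n * L + n mod L" for n by (simp add: m_def)
  have nL: "n mod L \<le> L" for n using L by (simp add: less_imp_le)
  have "filterlim m at_top sequentially"
    unfolding filterlim_at_top
  proof
    fix Z
    show "eventually (\<lambda>n. Z \<le> m n) sequentially"
      unfolding eventually_sequentially m_def
      by (intro exI[of _ "Z * L"]) (use L in \<open>auto simp: less_eq_div_iff_mult_less_eq\<close>)
  qed
  from filterlim_compose[OF lim this]
  have 1: "(\<lambda>n. S (m n * L) / real (m n * L)) \<longlonglongrightarrow> s" by (simp add: S_def)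
  have Ln: "(\<lambda>n. real L / real n) \<longlonglongrightarrow> 0" by real_asymp
  have small: "(\<lambda>n. b n / real n) \<longlonglongrightarrow> 0" if "\<And>n. 0 \<le> b n" "\<And>n. b n \<le> real L" for b :: "nat \<Rightarrow> real"
    by (rule tendsto_sandwich[OF _ _ tendsto_const Ln])
      (use that in \<open>auto intro!: always_eventually divide_right_mono\<close>)
  have "(\<lambda>n. S (m n * L) / real (m n * L) * (1 - real (n mod L) / real n) + (S n - S (m n * L)) / real n) \<longlonglongrightarrow> s * (1 - 0) + 0"
  proof (intro tendsto_intros 1 small)
    fix n
    have "S n - S (m n * L) = (\<Sum>i\<in>{m n * L..<n}. a i)"
      unfolding S_def using n[of n] by (subst sum_diff_nat_ivl[of 0, folded lessThan_atLeast0]) auto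
    moreover have "(\<Sum>i\<in>{m n * L..<n}. a i) \<le> (\<Sum>i\<in>{m n * L..<n}. 1)" by (intro sum_mono a)
    moreover have "n - m n * L \<le> L" using n[of n] nL[of n] by linarith
    ultimately show "0 \<le> S n - S (m n * L)" "S n - S (m n * L) \<le> real L"
      by (auto intro!: sum_nonneg a)
  qed (use nL in auto)
  moreover have "eventually (\<lambda>n. S (m n * L) / real (m n * L) * (1 - real (n mod L) / real n)
      + (S n - S (m n * L)) / real n = S n / real n) sequentially"
    using eventually_ge_at_top[of L]
  proof eventually_elim
    case (elim n)
    have "m n > 0" "n > 0" using elim L by (auto simp: m_def div_greater_zero_iff)
    have "1 - real (n mod L) / real n = real (m n * L) / real n"
      using \<open>n > 0\<close> arg_cong[OF n[of n], of real] by (simp add: field_simps)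
    then have "S (m n * L) / real (m n * L) * (1 - real (n mod L) / real n) = S (m n * L) / real n"
      using \<open>m n > 0\<close> L by simp
    then show ?case by (simp add: diff_divide_distrib)
  qed
  ultimately show ?thesis unfolding S_def by (simp add: tendsto_cong)
qed

lemma sum_residue_classes:
  fixes a :: "nat \<Rightarrow> real"
  shows "(\<Sum>i<m * L. a i) = (\<Sum>r<L. \<Sum>k<m. a (k * L + r))"
proof (induction m)
  case (Suc m)
  have "(\<Sum>i<Suc m * L. a i) = (\<Sum>i<m * L. a i) + (\<Sum>i\<in>{m * L..<m * L + L}. a i)"
    by (simp add: lessThan_atLeast0 sum.atLeastLessThan_concat add.commute)
  also have "(\<Sum>i\<in>{m * L..<m * L + L}. a i) = (\<Sum>r<L. a (m * L + r))"
    using sum.shift_bounds_nat_ivl[of a 0 "m * L" L] by (simp add: lessThan_atLeast0 add.commute)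
  finally show ?case using Suc by (simp add: sum.distrib)
qed simp

text \<open>
  Writing \<open>i = k * L + r\<close>, the set of source sequences whose coded image shifted by \<open>i\<close> lies in \<open>B\<close> is
  the preimage under \<open>k\<close> source shifts of a set that depends on \<open>r\<close> alone. So each residue class \<open>r\<close>
  contributes an ordinary shift average of \<open>M\<close>.
\<close>

lemma shift_average_coded_tendsto:
  fixes M :: "(int \<Rightarrow> 'a::countable) measure" and f :: "'a \<Rightarrow> 'b::countable list"
  assumes M: "ams M" and f: "\<And>x. length (f x) = L" and L: "L \<ge> 1"
    and B: "B \<in> sets seq_space"
  shows "shift_average (distr M seq_space (two_sided_concat f)) B \<longlonglongrightarrow>
    (\<Sum>r<L. measure (stationary_mean M) (two_sided_concat f -` (shift ^^ r) -` B)) / real L"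
proof -
  interpret prob_space M using M by (simp add: ams_def)
  have sets_M: "sets M = sets seq_space" using M by (simp add: ams_def)
  have space_M: "space M = UNIV" using sets_eq_imp_space_eq[OF sets_M] by simp
  let ?F = "two_sided_concat f"
  let ?N = "distr M seq_space ?F"
  have F: "?F \<in> seq_space \<rightarrow>\<^sub>M seq_space" by (rule measurable_two_sided_concat[OF f L])
  then have F': "?F \<in> M \<rightarrow>\<^sub>M seq_space" by (simp add: measurable_cong_sets[OF sets_M refl])
  define C where "C r = ?F -` (shift ^^ r) -` B" for r
  have C: "C r \<in> sets seq_space" for r
    unfolding C_def using measurable_sets[OF F vimage_shift_funpow_sets[OF B]] by simp
  define a where "a i = measure ?N ((shift ^^ i) -` B)" for i
  have a: "a (k * L + r) = measure M ((shift ^^ k) -` C r)" for k r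
  proof -
    have "(shift ^^ (k * L + r)) (?F x) = (shift ^^ r) (?F ((shift ^^ k) x))" for x
      unfolding two_sided_concat_shift[OF f L] by (simp add: add.commute[of _ r] funpow_add)
    then have "?F -` (shift ^^ (k * L + r)) -` B = (shift ^^ k) -` C r"
      by (auto simp: C_def)
    then show ?thesis
      unfolding a_def by (subst measure_distr[OF F']) (auto simp: space_M vimage_shift_funpow_sets B)
  qed
  have "(\<lambda>m. (\<Sum>i<m * L. a i) / real (m * L)) = (\<lambda>m. (\<Sum>r<L. shift_average M (C r) m) / real L)"
    by (simp add: sum_residue_classes a shift_average_def sum_divide_distrib)
  moreover have "(\<lambda>m. (\<Sum>r<L. shift_average M (C r) m) / real L) \<longlonglongrightarrow>
      (\<Sum>r<L. measure (stationary_mean M) (C r)) / real L"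
    using L by (intro tendsto_divide tendsto_sum shift_average_tendsto M C) auto
  ultimately have "(\<lambda>m. (\<Sum>i<m * L. a i) / real (m * L)) \<longlonglongrightarrow>
      (\<Sum>r<L. measure (stationary_mean M) (C r)) / real L" by simp
  then have "(\<lambda>n. (\<Sum>i<n. a i) / real n) \<longlonglongrightarrow> (\<Sum>r<L. measure (stationary_mean M) (C r)) / real L"
    by (intro averages_tendsto_from_multiples[OF _ _ L])
      (auto simp: a_def intro: prob_space.prob_le_1[OF prob_space_distr[OF F']])
  then show ?thesis by (simp add: shift_average_def[abs_def] a_def C_def)
qed

lemma ams_coded:
  fixes M :: "(int \<Rightarrow> 'a::countable) measure" and f :: "'a \<Rightarrow> 'b::countable list"
  assumes M: "ams M" and f: "\<And>x. length (f x) = L" and L: "L \<ge> 1"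
  shows "ams (distr M seq_space (two_sided_concat f))"
proof -
  interpret prob_space M using M by (simp add: ams_def)
  have sets_M: "sets M = sets seq_space" using M by (simp add: ams_def)
  have "two_sided_concat f \<in> M \<rightarrow>\<^sub>M seq_space"
    unfolding measurable_cong_sets[OF sets_M refl] by (rule measurable_two_sided_concat[OF f L])
  then have "prob_space (distr M seq_space (two_sided_concat f))" by (rule prob_space_distr)
  moreover have "convergent (shift_average (distr M seq_space (two_sided_concat f)) B)"
    if "B \<in> sets seq_space" for B
    using shift_average_coded_tendsto[OF M f L that] by (rule convergentI)
  ultimately show ?thesis by (simp add: ams_def)
qed

lemma measure_stationary_mean_coded:
  fixes M :: "(int \<Rightarrow> 'a::countable) measure" and f :: "'a \<Rightarrow> 'b::countable list"
  assumes "ams M" "\<And>x. length (f x) = L" "L \<ge> 1" "B \<in> sets seq_space"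
  shows "measure (stationary_mean (distr M seq_space (two_sided_concat f))) B =
    (\<Sum>r<L. measure (stationary_mean M) (two_sided_concat f -` (shift ^^ r) -` B)) / real L"
proof (rule LIMSEQ_unique)
  show "shift_average (distr M seq_space (two_sided_concat f)) B \<longlonglongrightarrow>
      measure (stationary_mean (distr M seq_space (two_sided_concat f))) B"
    by (rule shift_average_tendsto[OF ams_coded[OF assms(1-3)] assms(4)])
  show "shift_average (distr M seq_space (two_sided_concat f)) B \<longlonglongrightarrow>
      (\<Sum>r<L. measure (stationary_mean M) (two_sided_concat f -` (shift ^^ r) -` B)) / real L"
    by (rule shift_average_coded_tendsto[OF assms])
qed

section \<open>Entropy of discrete distributions\<close>

text \<open>
  Shannon entropy (natural logarithm) as the expectation of the nonnegative function \<open>- ln p\<close>. As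
  an expectation under \<open>p\<close> itself it ignores the points where \<open>p\<close> vanishes.
\<close>

definition pmf_entropy :: "'a pmf \<Rightarrow> ennreal" where
  "pmf_entropy p = (\<integral>\<^sup>+x. ennreal (- ln (pmf p x)) \<partial>measure_pmf p)"

text \<open>
  From \<open>ln t \<le> t - 1\<close> with \<open>t = q x / p x\<close>. Since the values may be infinite, nothing can be
  subtracted; the inequality is integrated in the form
  \<open>- ln p + 1 \<le> - ln q + q / p\<close>, whose last term has expectation at most \<open>1\<close> under \<open>p\<close>.
\<close>

lemma gibbs_inequality:
  assumes "set_pmf p \<subseteq> set_pmf q"
  shows "pmf_entropy p \<le> (\<integral>\<^sup>+x. ennreal (- ln (pmf q x)) \<partial>measure_pmf p)"
proof -
  have "pmf_entropy p + 1 = (\<integral>\<^sup>+x. ennreal (- ln (pmf p x)) + 1 \<partial>measure_pmf p)"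
    by (simp add: pmf_entropy_def nn_integral_add)
  also have "\<dots> \<le> (\<integral>\<^sup>+x. ennreal (- ln (pmf q x)) + ennreal (pmf q x / pmf p x) \<partial>measure_pmf p)"
  proof (intro nn_integral_mono_AE AE_pmfI)
    fix x assume x: "x \<in> set_pmf p"
    have p: "0 < pmf p x" and q: "0 < pmf q x" using x assms by (auto intro: pmf_positive)
    have "ln (pmf q x / pmf p x) \<le> pmf q x / pmf p x - 1"
      using p q by (intro ln_le_minus_one) simp
    then have "- ln (pmf p x) + 1 \<le> - ln (pmf q x) + pmf q x / pmf p x"
      using p q by (simp add: ln_div)
    moreover have "0 \<le> - ln (pmf p x)" "0 \<le> - ln (pmf q x)"
      using p q pmf_le_1[of p x] pmf_le_1[of q x] by simp_all
    ultimately have "ennreal (- ln (pmf p x) + 1) \<le> ennreal (- ln (pmf q x) + pmf q x / pmf p x)"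
      by (intro ennreal_leI)
    then show "ennreal (- ln (pmf p x)) + 1 \<le> ennreal (- ln (pmf q x)) + ennreal (pmf q x / pmf p x)"
      using \<open>0 \<le> - ln (pmf p x)\<close> \<open>0 \<le> - ln (pmf q x)\<close> p q
      by (subst (asm) (1 2) ennreal_plus) simp_all
  qed
  also have "\<dots> = (\<integral>\<^sup>+x. ennreal (- ln (pmf q x)) \<partial>measure_pmf p)
      + (\<integral>\<^sup>+x. ennreal (pmf q x / pmf p x) \<partial>measure_pmf p)"
    by (simp add: nn_integral_add)
  also have "(\<integral>\<^sup>+x. ennreal (pmf q x / pmf p x) \<partial>measure_pmf p) \<le> (\<integral>\<^sup>+x. ennreal (pmf q x) \<partial>count_space UNIV)"
    unfolding nn_integral_measure_pmf
    by (intro nn_integral_mono) (simp add: pmf_nonneg flip: ennreal_mult)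
  also have "(\<integral>\<^sup>+x. ennreal (pmf q x) \<partial>count_space UNIV) = 1"
    by (simp add: nn_integral_pmf measure_pmf.emeasure_space_1[unfolded space_measure_pmf])
  finally show ?thesis by (simp add: add_left_mono)
qed

text \<open>
  Merging points only enlarges their probabilities.
\<close>

lemma pmf_entropy_map_le: "pmf_entropy (map_pmf g p) \<le> pmf_entropy p"
  unfolding pmf_entropy_def nn_integral_map_pmf
proof (intro nn_integral_mono_AE AE_pmfI ennreal_leI)
  fix x assume "x \<in> set_pmf p"
  then have "0 < pmf p x" by (rule pmf_positive)
  moreover have "pmf p x \<le> pmf (map_pmf g p) (g x)"
    unfolding pmf_map by (subst pmf.rep_eq, rule measure_pmf.finite_measure_mono) auto
  ultimately show "- ln (pmf (map_pmf g p) (g x)) \<le> - ln (pmf p x)" by simp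
qed

text \<open>
  Gibbs' inequality against the product of the marginals, where the logarithm splits into a sum.
\<close>

lemma pmf_entropy_subadditive:
  "pmf_entropy p \<le> pmf_entropy (map_pmf fst p) + pmf_entropy (map_pmf snd p)"
proof -
  let ?q = "pair_pmf (map_pmf fst p) (map_pmf snd p)"
  have "set_pmf p \<subseteq> set_pmf ?q" by force
  then have "pmf_entropy p \<le> (\<integral>\<^sup>+x. ennreal (- ln (pmf ?q x)) \<partial>measure_pmf p)" by (rule gibbs_inequality)
  also have "\<dots> = (\<integral>\<^sup>+x. ennreal (- ln (pmf (map_pmf fst p) (fst x)))
      + ennreal (- ln (pmf (map_pmf snd p) (snd x))) \<partial>measure_pmf p)"
  proof (intro nn_integral_cong_AE AE_pmfI)
    fix x assume x: "x \<in> set_pmf p"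
    then have "fst x \<in> set_pmf (map_pmf fst p)" "snd x \<in> set_pmf (map_pmf snd p)" by auto
    then have *: "0 < pmf (map_pmf fst p) (fst x)" "0 < pmf (map_pmf snd p) (snd x)"
      by (blast intro: pmf_positive)+
    have "pmf ?q x = pmf (map_pmf fst p) (fst x) * pmf (map_pmf snd p) (snd x)"
      by (metis pmf_pair prod.collapse)
    then show "ennreal (- ln (pmf ?q x)) = ennreal (- ln (pmf (map_pmf fst p) (fst x)))
      + ennreal (- ln (pmf (map_pmf snd p) (snd x)))"
      using * by (simp add: ln_mult pmf_le_1 flip: ennreal_plus)
  qed
  also have "\<dots> = pmf_entropy (map_pmf fst p) + pmf_entropy (map_pmf snd p)"
    by (simp add: nn_integral_add pmf_entropy_def)
  finally show ?thesis .
qed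

text \<open>
  The entropy of the mixture is the average over \<open>i\<close> of the cross entropies of \<open>q i\<close> relative to
  the mixture, and by Gibbs' inequality each of these is at least the entropy of \<open>q i\<close>.
\<close>

lemma pmf_entropy_mixture_ge:
  assumes "\<And>i. i \<in> set_pmf I \<Longrightarrow> c \<le> pmf_entropy (q i)"
  shows "c \<le> pmf_entropy (bind_pmf I q)"
proof -
  have "c = (\<integral>\<^sup>+i. c \<partial>measure_pmf I)" by (simp add: measure_pmf.emeasure_space_1[unfolded space_measure_pmf])
  also have "\<dots> \<le> (\<integral>\<^sup>+i. (\<integral>\<^sup>+x. ennreal (- ln (pmf (bind_pmf I q) x)) \<partial>measure_pmf (q i)) \<partial>measure_pmf I)"
  proof (intro nn_integral_mono_AE AE_pmfI)
    fix i assume i: "i \<in> set_pmf I"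
    have "c \<le> pmf_entropy (q i)" using assms i .
    also have "\<dots> \<le> (\<integral>\<^sup>+x. ennreal (- ln (pmf (bind_pmf I q) x)) \<partial>measure_pmf (q i))"
      using i by (intro gibbs_inequality) auto
    finally show "c \<le> \<dots>" .
  qed
  also have "\<dots> = pmf_entropy (bind_pmf I q)"
    unfolding pmf_entropy_def by simp
  finally show ?thesis .
qed

text \<open>
  The mixture dominates \<open>q i / card J\<close> pointwise, so its \<open>- ln\<close> exceeds that of \<open>q i\<close> by at
  most \<open>ln (card J)\<close>.
\<close>

lemma pmf_entropy_mixture_le:
  assumes I: "finite J" "J \<noteq> {}"
    and c: "\<And>i. i \<in> J \<Longrightarrow> pmf_entropy (q i) \<le> c"
  shows "pmf_entropy (bind_pmf (pmf_of_set J) q) \<le> c + ennreal (ln (card J))"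
proof -
  let ?I = "pmf_of_set J" let ?m = "bind_pmf ?I q"
  have J: "0 < card J" using I by (simp add: card_gt_0_iff)
  have "pmf_entropy ?m = (\<integral>\<^sup>+i. (\<integral>\<^sup>+x. ennreal (- ln (pmf ?m x)) \<partial>measure_pmf (q i)) \<partial>measure_pmf ?I)"
    unfolding pmf_entropy_def by simp
  also have "\<dots> \<le> (\<integral>\<^sup>+i. c + ennreal (ln (card J)) \<partial>measure_pmf ?I)"
  proof (intro nn_integral_mono_AE AE_pmfI)
    fix i assume "i \<in> set_pmf ?I"
    then have i: "i \<in> J" using I by (simp add: set_pmf_of_set)
    have "(\<integral>\<^sup>+x. ennreal (- ln (pmf ?m x)) \<partial>measure_pmf (q i))
        \<le> (\<integral>\<^sup>+x. ennreal (- ln (pmf (q i) x)) + ennreal (ln (card J)) \<partial>measure_pmf (q i))"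
    proof (intro nn_integral_mono_AE AE_pmfI)
      fix x assume x: "x \<in> set_pmf (q i)"
      have p: "0 < pmf (q i) x" using x by (rule pmf_positive)
      have "pmf ?m x = (\<Sum>j\<in>J. pmf (q j) x) / card J"
        using I by (simp add: pmf_bind integral_pmf_of_set)
      moreover have "pmf (q i) x \<le> (\<Sum>j\<in>J. pmf (q j) x)"
        using I i by (intro member_le_sum) auto
      ultimately have "pmf (q i) x / card J \<le> pmf ?m x"
        by (simp add: divide_right_mono)
      then have "ln (pmf (q i) x / card J) \<le> ln (pmf ?m x)"
        using p J by (subst ln_le_cancel_iff) (auto intro: less_le_trans[of 0 "pmf (q i) x / card J"])
      then have "- ln (pmf ?m x) \<le> - ln (pmf (q i) x) + ln (card J)"
        using p J by (simp add: ln_div)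
      moreover have "0 \<le> - ln (pmf (q i) x)" "0 \<le> ln (card J)"
        using p J pmf_le_1[of "q i" x] by simp_all
      ultimately show "ennreal (- ln (pmf ?m x)) \<le> ennreal (- ln (pmf (q i) x)) + ennreal (ln (card J))"
        by (simp add: ennreal_leI flip: ennreal_plus)
    qed
    also have "\<dots> = pmf_entropy (q i) + ennreal (ln (card J))"
      by (simp add: nn_integral_add pmf_entropy_def measure_pmf.emeasure_space_1[unfolded space_measure_pmf])
    also have "\<dots> \<le> c + ennreal (ln (card J))" using c[OF i] by (simp add: add_right_mono)
    finally show "(\<integral>\<^sup>+x. ennreal (- ln (pmf ?m x)) \<partial>measure_pmf (q i)) \<le> c + ennreal (ln (card J))" .
  qed
  also have "\<dots> = c + ennreal (ln (card J))"
    by (simp add: measure_pmf.emeasure_space_1[unfolded space_measure_pmf])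
  finally show ?thesis .
qed

text \<open>
  Both sides are suprema of finite partial sums; on the integral side, monotone convergence along
  the finite sets of the first \<open>n\<close> elements of an enumeration suffices.
\<close>

lemma nn_integral_count_space_conv_infsum:
  fixes g :: "'a::countable \<Rightarrow> real"
  assumes g: "\<And>x. x \<in> A \<Longrightarrow> 0 \<le> g x" and out: "\<And>x. x \<notin> A \<Longrightarrow> g x = 0"
  shows "infsum (\<lambda>x. ereal (g x)) A = enn2ereal (\<integral>\<^sup>+x. ennreal (g x) \<partial>count_space UNIV)"
proof -
  have g0: "0 \<le> g x" for x using g out by (cases "x \<in> A") auto
  have sum_eq: "(\<integral>\<^sup>+x. ennreal (g x) * indicator F x \<partial>count_space UNIV) = ennreal (sum g F)"
    if "finite F" for F
    using that by (subst nn_integral_count_space'[where A = F]) (auto simp: sum_ennreal g0)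
  have "infsum (\<lambda>x. ereal (g x)) A = infsum (\<lambda>x. ereal (g x)) UNIV"
    by (rule infsum_cong_neutral) (auto simp: out)
  also have "\<dots> = (SUP F\<in>{F. finite F \<and> F \<subseteq> UNIV}. (\<Sum>x\<in>F. ereal (g x)))"
    by (rule nonneg_infsum_complete) (simp add: g0)
  also have "\<dots> = enn2ereal (\<integral>\<^sup>+x. ennreal (g x) \<partial>count_space UNIV)"
  proof (rule antisym)
    show "(SUP F\<in>{F. finite F \<and> F \<subseteq> UNIV}. (\<Sum>x\<in>F. ereal (g x))) \<le> enn2ereal (\<integral>\<^sup>+x. ennreal (g x) \<partial>count_space UNIV)"
    proof (rule SUP_least)
      fix F :: "'a set" assume "F \<in> {F. finite F \<and> F \<subseteq> UNIV}"
      then have F: "finite F" by simp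
      have "ennreal (sum g F) \<le> (\<integral>\<^sup>+x. ennreal (g x) \<partial>count_space UNIV)"
        unfolding sum_eq[OF F, symmetric] by (intro nn_integral_mono) (auto split: split_indicator)
      then show "(\<Sum>x\<in>F. ereal (g x)) \<le> enn2ereal (\<integral>\<^sup>+x. ennreal (g x) \<partial>count_space UNIV)"
        by (simp add: less_eq_ennreal.rep_eq enn2ereal_ennreal sum_nonneg g0)
    qed
  next
    define F where "F n = {x::'a. to_nat x < n}" for n
    have fin: "finite (F n)" for n
      by (rule finite_imageD[of to_nat]) (auto simp: F_def intro: finite_subset[of _ "{..<n}"] inj_on_subset[OF inj_to_nat])
    have "(\<integral>\<^sup>+x. ennreal (g x) \<partial>count_space UNIV) = (\<integral>\<^sup>+x. (SUP n. ennreal (g x) * indicator (F n) x) \<partial>count_space UNIV)"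
    proof (intro nn_integral_cong antisym SUP_least)
      fix x show "ennreal (g x) \<le> (SUP n. ennreal (g x) * indicator (F n) x)"
        by (rule SUP_upper2[of "Suc (to_nat x)"]) (auto simp: F_def)
    qed (auto split: split_indicator)
    also have "\<dots> = (SUP n. \<integral>\<^sup>+x. ennreal (g x) * indicator (F n) x \<partial>count_space UNIV)"
      by (rule nn_integral_monotone_convergence_SUP)
         (auto simp: incseq_def le_fun_def F_def split: split_indicator)
    also have "\<dots> = (SUP n. ennreal (sum g (F n)))" by (simp add: sum_eq fin)
    finally have *: "(\<integral>\<^sup>+x. ennreal (g x) \<partial>count_space UNIV) = (SUP n. ennreal (sum g (F n)))" .
    show "enn2ereal (\<integral>\<^sup>+x. ennreal (g x) \<partial>count_space UNIV) \<le> (SUP F\<in>{F. finite F \<and> F \<subseteq> UNIV}. (\<Sum>x\<in>F. ereal (g x)))"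
      unfolding *
      by (subst Sup_ennreal.rep_eq)
        (auto simp: enn2ereal_ennreal sum_nonneg g0 image_image fin
          intro!: SUP_least intro: SUP_upper2[of "{}"] SUP_upper2[of "F _"])
  qed
  finally show ?thesis .
qed

section \<open>Laws of blocks\<close>

definition discrete_law :: "'a measure \<Rightarrow> ('a \<Rightarrow> 'c) \<Rightarrow> 'c pmf" where
  "discrete_law M X = Abs_pmf (distr M (count_space UNIV) X)"

text \<open>
  A distribution on a countable type is concentrated on its atoms, which is what the type of
  probability mass functions demands.
\<close>

lemma (in prob_space) measure_pmf_discrete_law:
  fixes X :: "'a \<Rightarrow> 'c::countable"
  assumes X: "X \<in> M \<rightarrow>\<^sub>M count_space UNIV"
  shows "measure_pmf (discrete_law M X) = distr M (count_space UNIV) X"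
proof -
  interpret D: prob_space "distr M (count_space UNIV) X" using X by (rule prob_space_distr)
  have "AE x in distr M (count_space UNIV) X. measure (distr M (count_space UNIV) X) {x} \<noteq> 0"
    by (subst D.AE_support_countable) (auto intro: exI[of _ UNIV])
  then show ?thesis
    unfolding discrete_law_def by (intro Abs_pmf_inverse) (auto simp: D.prob_space_axioms)
qed

lemma (in prob_space) pmf_discrete_law:
  fixes X :: "'a \<Rightarrow> 'c::countable"
  assumes X: "X \<in> M \<rightarrow>\<^sub>M count_space UNIV"
  shows "pmf (discrete_law M X) y = measure M (X -` {y} \<inter> space M)"
  using X by (simp add: pmf.rep_eq measure_pmf_discrete_law measure_distr)

lemma (in prob_space) map_pmf_discrete_law:
  fixes X :: "'a \<Rightarrow> 'c::countable" and g :: "'c \<Rightarrow> 'd::countable"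
  assumes X: "X \<in> M \<rightarrow>\<^sub>M count_space UNIV"
  shows "map_pmf g (discrete_law M X) = discrete_law M (\<lambda>x. g (X x))"
proof (rule pmf_eqI)
  fix y
  have gX: "(\<lambda>x. g (X x)) \<in> M \<rightarrow>\<^sub>M count_space UNIV"
    by (rule measurable_compose[OF X]) simp
  have "(\<lambda>x. g (X x)) -` {y} = X -` g -` {y}" by auto
  then show "pmf (map_pmf g (discrete_law M X)) y = pmf (discrete_law M (\<lambda>x. g (X x))) y"
    using X by (simp add: pmf_map measure_pmf_discrete_law measure_distr pmf_discrete_law[OF gX])
qed

lemma (in prob_space) entropy_discrete_law_le_if_determined:
  fixes X :: "'a \<Rightarrow> 'c::countable" and Y :: "'a \<Rightarrow> 'd::countable"
  assumes "X \<in> M \<rightarrow>\<^sub>M count_space UNIV" and "\<And>x. Y x = g (X x)"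
  shows "pmf_entropy (discrete_law M Y) \<le> pmf_entropy (discrete_law M X)"
proof -
  have "Y = (\<lambda>x. g (X x))" using assms(2) by auto
  then have "discrete_law M Y = map_pmf g (discrete_law M X)"
    using assms(1) by (simp add: map_pmf_discrete_law)
  then show ?thesis by (simp add: pmf_entropy_map_le)
qed

definition block :: "int \<Rightarrow> nat \<Rightarrow> (int \<Rightarrow> 'a) \<Rightarrow> 'a list" where
  "block a k x = map (\<lambda>i. x (a + int i)) [0..<k]"

lemma length_block [simp]: "length (block a k x) = k"
  by (simp add: block_def)

lemma nth_block [simp]: "i < k \<Longrightarrow> block a k x ! i = x (a + int i)"
  by (simp add: block_def)

lemma block_add: "block a (k + l) x = block a k x @ block (a + int k) l x"
  by (rule nth_equalityI) (auto simp: nth_append)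

lemma block_shift_funpow: "block a k ((shift ^^ r) x) = block (a + int r) k x"
  by (simp add: block_def shift_funpow algebra_simps)

lemma cylinder_eq_block: "cylinder u = block 1 (length u) -` {u}"
  by (auto simp: cylinder_def list_eq_iff_nth_eq add.commute)

lemma measurable_block:
  "(block a k :: (int \<Rightarrow> 'a::countable) \<Rightarrow> 'a list) \<in> seq_space \<rightarrow>\<^sub>M count_space UNIV"
proof (induction k)
  case 0
  then show ?case by (simp add: block_def)
next
  case (Suc k)
  have "(\<lambda>x. x (a + int k)) \<in> seq_space \<rightarrow>\<^sub>M count_space (UNIV :: 'a set)" by (rule measurable_coordinate)
  then have "(\<lambda>x. u @ [x (a + int k)]) \<in> seq_space \<rightarrow>\<^sub>M count_space UNIV" for u :: "'a list"
    by (rule measurable_compose) simp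
  then have "(\<lambda>x. block a k x @ [x (a + int k)]) \<in> seq_space \<rightarrow>\<^sub>M count_space (UNIV :: 'a list set)"
    using Suc by (rule measurable_compose_countable)
  moreover have "block a (Suc k) = (\<lambda>x::int \<Rightarrow> 'a. block a k x @ [x (a + int k)])"
    by (simp add: fun_eq_iff block_def)
  ultimately show ?case by simp
qed

lemma block_entropy_eq_pmf_entropy:
  fixes M :: "(int \<Rightarrow> 'a::countable) measure"
  assumes "prob_space M" and sets: "sets M = sets seq_space"
  shows "block_entropy M k = enn2ereal (pmf_entropy (discrete_law M (block 1 k)))"
proof -
  interpret prob_space M by fact
  have space: "space M = UNIV" using sets_eq_imp_space_eq[OF sets] by simp
  have blk: "block 1 k \<in> M \<rightarrow>\<^sub>M count_space UNIV"
    unfolding measurable_cong_sets[OF sets refl] by (rule measurable_block)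
  define p where "p u = pmf (discrete_law M (block 1 k)) u" for u
  have p: "p u = measure M (block 1 k -` {u})" for u
    using pmf_discrete_law[OF blk] by (simp add: p_def space)
  have g0: "0 \<le> - (p u * ln (p u))" for u
    using pmf_le_1[of "discrete_law M (block 1 k)" u] pmf_nonneg[of "discrete_law M (block 1 k)" u]
    by (cases "p u = 0") (auto simp: p_def mult_nonneg_nonpos)
  have "block_entropy M k = (\<Sum>\<^sub>\<infinity>u\<in>{u. length u = k}. ereal (- (p u * ln (p u))))"
    unfolding block_entropy_def by (rule infsum_cong) (auto simp: p cylinder_eq_block)
  also have "\<dots> = enn2ereal (\<integral>\<^sup>+u. ennreal (- (p u * ln (p u))) \<partial>count_space UNIV)"
  proof (rule nn_integral_count_space_conv_infsum)
    fix u :: "'a list" assume "u \<notin> {u. length u = k}"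
    then have "block 1 k -` {u} = {}" by auto
    then show "- (p u * ln (p u)) = 0" by (simp add: p)
  qed (rule g0)
  also have "(\<integral>\<^sup>+u. ennreal (- (p u * ln (p u))) \<partial>count_space UNIV)
      = pmf_entropy (discrete_law M (block 1 k))"
    unfolding pmf_entropy_def nn_integral_measure_pmf p_def[symmetric]
  proof (rule nn_integral_cong)
    fix u
    show "ennreal (- (p u * ln (p u))) = ennreal (p u) * ennreal (- ln (p u))"
      by (subst ennreal_mult'[symmetric]) (simp_all add: p_def)
  qed
  finally show ?thesis .
qed

section \<open>Block entropies of a stationary measure\<close>

locale stationary_source = prob_space M
  for M :: "(int \<Rightarrow> 'a::countable) measure" +
  assumes sets_M: "sets M = sets seq_space"
    and stationary: "A \<in> sets seq_space \<Longrightarrow> measure M (shift -` A) = measure M A"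
begin

lemma space_M: "space M = UNIV"
  using sets_eq_imp_space_eq[OF sets_M] by simp

lemma measurable_block_M: "block a k \<in> M \<rightarrow>\<^sub>M count_space UNIV"
  unfolding measurable_cong_sets[OF sets_M refl] by (rule measurable_block)

abbreviation H :: "nat \<Rightarrow> ennreal" where
  "H k \<equiv> pmf_entropy (discrete_law M (block 1 k))"

text \<open>
  Stationarity enters the entropy bounds only here: the law of a block is independent of its position.
\<close>

lemma discrete_law_block: "discrete_law M (block (1 + int j) k) = discrete_law M (block 1 k)"
proof (induction j)
  case (Suc j)
  have "discrete_law M (block (1 + int (Suc j)) k) = discrete_law M (block (1 + int j) k)"
  proof (rule pmf_eqI)
    fix u :: "'a list"
    have "block (1 + int j) k -` {u} \<in> sets seq_space"
      using measurable_sets[OF measurable_block, of "{u}" "1 + int j" k] by simp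
    moreover have "block (1 + int (Suc j)) k -` {u} = shift -` block (1 + int j) k -` {u}"
      using block_shift_funpow[of "1 + int j" k 1] by (auto simp: add.commute add.left_commute)
    ultimately show "pmf (discrete_law M (block (1 + int (Suc j)) k)) u
        = pmf (discrete_law M (block (1 + int j) k)) u"
      by (simp add: pmf_discrete_law measurable_block_M space_M stationary del: of_nat_Suc)
  qed
  then show ?case using Suc by simp
qed simp

lemma H_mono: "k \<le> l \<Longrightarrow> H k \<le> H l"
  by (rule entropy_discrete_law_le_if_determined[where g = "take k"])
    (auto simp: measurable_block_M intro!: nth_equalityI)

text \<open>
  A block of length \<open>k + l\<close> is equivalent to the pair of its first \<open>k\<close> and last \<open>l\<close> symbols; by
  stationarity the second component has the law of a block that starts at coordinate \<open>1\<close>.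
\<close>

lemma H_add_le: "H (k + l) \<le> H k + H l"
proof -
  let ?p = "discrete_law M (block 1 (k + l))"
  let ?q = "map_pmf (\<lambda>u. (take k u, drop k u)) ?p"
  have split: "take k (block 1 (k + l) x) = block 1 k x" "drop k (block 1 (k + l) x) = block (1 + int k) l x"
    for x :: "int \<Rightarrow> 'a" by (simp_all add: block_add)
  have "?p = map_pmf (\<lambda>(u, v). u @ v) ?q" by (simp add: map_pmf_comp)
  then have "H (k + l) \<le> pmf_entropy ?q" by (metis pmf_entropy_map_le)
  also have "\<dots> \<le> pmf_entropy (map_pmf fst ?q) + pmf_entropy (map_pmf snd ?q)"
    by (rule pmf_entropy_subadditive)
  also have "map_pmf fst ?q = map_pmf (take k) ?p" by (simp only: map_pmf_comp fst_conv)
  also have "\<dots> = discrete_law M (block 1 k)"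
    by (simp add: map_pmf_discrete_law measurable_block_M split)
  also have "map_pmf snd ?q = map_pmf (drop k) ?p" by (simp only: map_pmf_comp snd_conv)
  also have "\<dots> = discrete_law M (block 1 l)"
    by (simp add: map_pmf_discrete_law measurable_block_M split discrete_law_block)
  finally show ?thesis .
qed

lemma H_finite:
  assumes "H 1 < \<infinity>" "k \<ge> 1"
  shows "H k < \<infinity>"
  using assms(2)
proof (induction k rule: dec_induct)
  case (step k)
  have "H (Suc k) \<le> H k + H 1" using H_add_le[of k 1] by simp
  also have "\<dots> < \<infinity>" using step.IH assms(1) by (simp add: less_top)
  finally show ?case .
qed (rule assms(1))

end

lemma stationary_source_stationary_mean:
  fixes M :: "(int \<Rightarrow> 'a::countable) measure"
  assumes "ams M"
  shows "stationary_source (stationary_mean M)"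
proof -
  interpret prob_space "stationary_mean M" by (rule prob_space_stationary_mean[OF assms])
  show ?thesis
    by unfold_locales (auto simp: sets_stationary_mean assms stationary_mean_vimage_shift)
qed

section \<open>Windows into the coded sequence\<close>

locale fixed_length_coded_source = stationary_source M
  for M :: "(int \<Rightarrow> 'a::countable) measure" +
  fixes f :: "'a \<Rightarrow> 'b::countable list" and L :: nat
  assumes length_code: "length (f x) = L" and L_ge_1: "L \<ge> 1" and inj_code: "inj f"
begin

lemma coded_coordinate:
  "two_sided_concat f x (1 + int k) = f (x (1 + int (k div L))) ! (k mod L)"
  using two_sided_concat_coordinate[of f L x "1 + int k", OF length_code L_ge_1]
  by (simp add: add.commute flip: zdiv_int zmod_int)

definition window :: "nat \<Rightarrow> nat \<Rightarrow> (int \<Rightarrow> 'a) \<Rightarrow> 'b list" where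
  "window n r x = block (1 + int r) (n * L) (two_sided_concat f x)"

lemma measurable_window: "window n r \<in> M \<rightarrow>\<^sub>M count_space UNIV"
  unfolding measurable_cong_sets[OF sets_M refl] window_def[abs_def]
  by (rule measurable_compose[OF measurable_two_sided_concat measurable_block])
    (rule length_code L_ge_1)+

lemma nth_window:
  "k < n * L \<Longrightarrow> window n r x ! k = f (x (1 + int ((r + k) div L))) ! ((r + k) mod L)"
  using coded_coordinate[of x "r + k"] by (simp add: window_def add.assoc)

text \<open>
  The last symbol of the window has offset \<open>r + n * L - 1 < (n + 1) * L\<close>, so \<open>n + 1\<close> code words cover
  the window.
\<close>

lemma entropy_window_le:
  assumes "r < L"
  shows "pmf_entropy (discrete_law M (window n r)) \<le> H (n + 1)"
proof (rule entropy_discrete_law_le_if_determined[OF measurable_block_M])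
  fix x :: "int \<Rightarrow> 'a"
  show "window n r x = map (\<lambda>k. f (block 1 (n + 1) x ! ((r + k) div L)) ! ((r + k) mod L)) [0..<n * L]"
  proof (rule nth_equalityI)
    fix k assume "k < length (window n r x)"
    then have k: "k < n * L" by (simp add: window_def)
    then have "r + k < (n + 1) * L" using assms by simp
    then have "(r + k) div L < n + 1" by (rule less_mult_imp_div_less)
    then show "window n r x ! k
        = map (\<lambda>k. f (block 1 (n + 1) x ! ((r + k) div L)) ! ((r + k) mod L)) [0..<n * L] ! k"
      using k by (simp add: nth_window)
  qed (simp add: window_def)
qed

text \<open>
  As \<open>r < L\<close>, the window contains the complete code words of \<open>x\<^sub>2 \<dots> x\<^sub>n\<close>; the code word of
  \<open>x\<^sub>j\<^sub>+\<^sub>2\<close> starts at position \<open>(j + 1) * L - r\<close> of the window. Decoding them recovers a block of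
  length \<open>n - 1\<close>.
\<close>

lemma entropy_window_ge:
  assumes "r < L"
  shows "H (n - 1) \<le> pmf_entropy (discrete_law M (window n r))"
proof -
  let ?g = "\<lambda>w. map (\<lambda>j. inv f (map (\<lambda>i. w ! ((j + 1) * L - r + i)) [0..<L])) [0..<n - 1]"
  have "pmf_entropy (discrete_law M (block (1 + int 1) (n - 1))) \<le> pmf_entropy (discrete_law M (window n r))"
  proof (rule entropy_discrete_law_le_if_determined[OF measurable_window])
    fix x
    show "block (1 + int 1) (n - 1) x = ?g (window n r x)"
    proof (rule nth_equalityI)
      fix j assume "j < length (block (1 + int 1) (n - 1) x)"
      then have j: "j < n - 1" by simp
      have "map (\<lambda>i. window n r x ! ((j + 1) * L - r + i)) [0..<L] = f (x (2 + int j))"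
      proof (rule nth_equalityI)
        fix i assume "i < length (map (\<lambda>i. window n r x ! ((j + 1) * L - r + i)) [0..<L])"
        then have i: "i < L" by simp
        have "(j + 2) * L \<le> n * L" using j by (intro mult_le_mono1) simp
        then have "(j + 1) * L - r + i < n * L" using i by (simp add: algebra_simps)
        moreover have "r + ((j + 1) * L - r + i) = i + (j + 1) * L" using assms by simp
        ultimately have "window n r x ! ((j + 1) * L - r + i)
            = f (x (1 + int ((i + (j + 1) * L) div L))) ! ((i + (j + 1) * L) mod L)"
          by (simp only: nth_window)
        also have "(i + (j + 1) * L) div L = j + 1" using i by (subst div_mult_self1) simp_all
        also have "(i + (j + 1) * L) mod L = i" using i by (subst mod_mult_self1) simp
        also have "1 + int (j + 1) = 2 + int j" by simp
        finally show "map (\<lambda>i. window n r x ! ((j + 1) * L - r + i)) [0..<L] ! i = f (x (2 + int j)) ! i"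
          using i by simp
      qed (simp add: length_code)
      then show "block (1 + int 1) (n - 1) x ! j = ?g (window n r x) ! j"
        using j inj_code by simp
    qed simp
  qed
  then show ?thesis by (simp only: discrete_law_block)
qed

end

section \<open>Comparison of the block entropies\<close>

theorem corollary6p6:
  fixes \<mu> :: "(int \<Rightarrow> 'a::countable) measure"
    and \<nu> :: "(int \<Rightarrow> 'b::countable) measure"
    and f :: "'a \<Rightarrow> 'b list"
    and L n :: nat
  assumes "ams \<mu>"
    and "L \<ge> 1"
    and "\<And>x. length (f x) = L"
    and "inj f"
    and "\<nu> = distr \<mu> seq_space (two_sided_concat f)"
    and "n \<ge> 1"
  shows "\<bar>block_entropy (stationary_mean \<nu>) (n * L) - block_entropy (stationary_mean \<mu>) n\<bar>
           \<le> block_entropy (stationary_mean \<mu>) 2 + ereal (ln (real L))"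
proof -
  interpret stationary_source "stationary_mean \<mu>" by (rule stationary_source_stationary_mean[OF assms(1)])
  interpret fixed_length_coded_source "stationary_mean \<mu>" f L by unfold_locales (fact assms)+
  have ams_\<nu>: "ams \<nu>" unfolding assms(5) by (rule ams_coded[OF assms(1,3,2)])
  interpret \<nu>: stationary_source "stationary_mean \<nu>" by (rule stationary_source_stationary_mean[OF ams_\<nu>])
  let ?J = "{..<L}"
  have J: "finite ?J" "?J \<noteq> {}" using assms(2) by (auto simp: lessThan_empty_iff)
  have mixture: "discrete_law (stationary_mean \<nu>) (block 1 (n * L))
      = bind_pmf (pmf_of_set ?J) (\<lambda>r. discrete_law (stationary_mean \<mu>) (window n r))"
  proof (rule pmf_eqI)
    fix u :: "'b list"
    have "block 1 (n * L) -` {u} \<in> sets seq_space"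
      using measurable_sets[OF measurable_block, of "{u}" 1 "n * L"] by simp
    then have "measure (stationary_mean \<nu>) (block 1 (n * L) -` {u})
        = (\<Sum>r<L. measure (stationary_mean \<mu>)
            (two_sided_concat f -` (shift ^^ r) -` block 1 (n * L) -` {u})) / real L"
      unfolding assms(5) by (rule measure_stationary_mean_coded[OF assms(1,3,2)])
    then have "pmf (discrete_law (stationary_mean \<nu>) (block 1 (n * L))) u
        = (\<Sum>r<L. measure (stationary_mean \<mu>)
            (two_sided_concat f -` (shift ^^ r) -` block 1 (n * L) -` {u})) / real L"
      by (simp add: \<nu>.pmf_discrete_law[OF \<nu>.measurable_block_M] \<nu>.space_M)
    also have "\<dots> = (\<Sum>r<L. measure (stationary_mean \<mu>) (window n r -` {u})) / real L"
    proof -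
      have "two_sided_concat f -` (shift ^^ r) -` block 1 (n * L) -` {u} = window n r -` {u}" for r
        by (auto simp: window_def block_shift_funpow)
      then show ?thesis by simp
    qed
    also have "\<dots>
        = pmf (bind_pmf (pmf_of_set ?J) (\<lambda>r. discrete_law (stationary_mean \<mu>) (window n r))) u"
      using J by (simp add: pmf_bind integral_pmf_of_set pmf_discrete_law measurable_window space_M)
    finally show "pmf (discrete_law (stationary_mean \<nu>) (block 1 (n * L))) u
        = pmf (bind_pmf (pmf_of_set ?J) (\<lambda>r. discrete_law (stationary_mean \<mu>) (window n r))) u" .
  qed
  have upper: "\<nu>.H (n * L) \<le> H n + H 1 + ennreal (ln (real L))"
  proof -
    have "\<nu>.H (n * L) \<le> H (n + 1) + ennreal (ln (real (card ?J)))"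
      unfolding mixture using J by (rule pmf_entropy_mixture_le) (simp only: lessThan_iff entropy_window_le)
    also have "\<dots> \<le> H n + H 1 + ennreal (ln (real L))"
      unfolding card_lessThan by (intro add_right_mono H_add_le)
    finally show ?thesis .
  qed
  have lower: "H n \<le> \<nu>.H (n * L) + H 1"
  proof -
    have "H n \<le> H (n - 1) + H 1" using H_add_le[of "n - 1" 1] assms(6) by simp
    also have "H (n - 1) \<le> \<nu>.H (n * L)"
      unfolding mixture by (rule pmf_entropy_mixture_ge) (use J entropy_window_ge[of _ n] in simp)
    finally show ?thesis by (simp add: add_right_mono)
  qed
  have H12: "H 1 \<le> H 2" by (rule H_mono) simp
  have entropies: "block_entropy (stationary_mean \<mu>) k = enn2ereal (H k)"
    "block_entropy (stationary_mean \<nu>) k = enn2ereal (\<nu>.H k)" for k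
    using block_entropy_eq_pmf_entropy prob_space_axioms sets_M \<nu>.prob_space_axioms \<nu>.sets_M by blast+
  have ln: "0 \<le> ln (real L)" using assms(2) by simp
  show ?thesis
  proof (cases "H 2 = \<infinity>")
    case True
    then show ?thesis by (simp add: entropies)
  next
    case False
    then have fin1: "H 1 < \<infinity>" using H12 by (simp add: less_top top_unique)
    have finn: "H n < \<infinity>" by (rule H_finite[OF fin1 assms(6)])
    have fin\<nu>: "\<nu>.H (n * L) < \<infinity>"
      by (rule le_less_trans[OF upper]) (use fin1 finn in simp)
    obtain h1 h2 hn g where h: "H 1 = ennreal h1" "H 2 = ennreal h2" "H n = ennreal hn" "\<nu>.H (n * L) = ennreal g"
      and nn: "0 \<le> h1" "0 \<le> h2" "0 \<le> hn" "0 \<le> g"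
      using False fin1 finn fin\<nu> by (metis ennreal_cases infinity_ennreal_def less_irrefl)
    have "g \<le> hn + h1 + ln (real L)" "hn \<le> g + h1" "h1 \<le> h2"
      using upper lower H12 ln nn unfolding h by (simp_all flip: ennreal_plus)
    then have "\<bar>g - hn\<bar> \<le> h2 + ln (real L)" using ln by linarith
    then show ?thesis by (simp add: entropies h enn2ereal_ennreal nn)
  qed
qed

end
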